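(* Let $t\in\mathbb{Z}_{\geq 0}$ and consider three-pile Nim with a one-time pass, where the pass is not allowed when all three piles have at most $t$ stones. The following are equivalent: (1) for every position $\{x,y,z,p\}$ of this game, $\{x,y,z,p\}$ is a $\mathcal{P}$-position if and only if $x\oplus y\oplus z\oplus p=0$; (2) $t$ is odd.
   Context: $\oplus$ denotes nim-sum (bitwise XOR of nonnegative integers). Game: there are three piles of stones, with $x$, $y$ and $z$ stones ($x,y,z\in\mathbb{Z}_{\geq 0}$). Two players alternate turns; on a turn a player removes any positive number of stones from one pile, or uses the pass move if it is available. The pass may be used at most once in the whole game: once it has been used by either player it is no longer available. The pass is not allowed when $x\leq t$, $y\leq t$ and $z\leq t$. The player who removes the last stone(s) wins. Positions: a position is an ordered quadruple $\{x,y,z,p\}$ with $p\in\{0,1\}$, where $p=1$ means the pass is still available and $p=0$ means it is not. Since the pass cannot be used when $x\leq t$, $y\leq t$ and $z\leq t$, in that case $p=0$; i.e. positions satisfy $p\leq F(x,y,z)$, where $F(x,y,z)=0$ if $x\leq t$, $y\leq t$ and $z\leq t$, and $F(x,y,z)=1$ otherwise. The moves from $\{x,y,z,p\}$ are: to $\{u,y,z,\min(p,F(u,y,z))\}$ for $0\leq u<x$; to $\{x,v,z,\min(p,F(x,v,z))\}$ for $0\leq v<y$; to $\{x,y,w,\min(p,F(x,y,w))\}$ for $0\leq w<z$; and, if $p=1$, to $\{x,y,z,0\}$ (the pass). A $\mathcal{P}$-position is a position from which the previous player (the player who just moved) wins with correct play; a player unable to move loses. *)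

theory Defs
  imports Main
begin

unbundle bit_operations_syntax

text \<open>A quadruple (x, y, z, p) holds the three pile sizes and the pass flag p, where
  p = 1 means that the pass is still available. The parameter t is the threshold: the pass is not
  allowed when all three piles have at most t stones.\<close>

type_synonym pos = "nat \<times> nat \<times> nat \<times> nat"

definition pass_bound :: "nat \<Rightarrow> nat \<Rightarrow> nat \<Rightarrow> nat \<Rightarrow> nat" where
  "pass_bound t x y z = (if x \<le> t \<and> y \<le> t \<and> z \<le> t then 0 else 1)"

fun is_position :: "nat \<Rightarrow> pos \<Rightarrow> bool" where
  "is_position t (x, y, z, p) \<longleftrightarrow> p \<in> {0, 1} \<and> p \<le> pass_bound t x y z"

inductive move :: "nat \<Rightarrow> pos \<Rightarrow> pos \<Rightarrow> bool" for t :: nat where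
  move_x: "u < x \<Longrightarrow> move t (x, y, z, p) (u, y, z, min p (pass_bound t u y z))"
| move_y: "v < y \<Longrightarrow> move t (x, y, z, p) (x, v, z, min p (pass_bound t x v z))"
| move_z: "w < z \<Longrightarrow> move t (x, y, z, p) (x, y, w, min p (pass_bound t x y w))"
| move_pass: "move t (x, y, z, 1) (x, y, z, 0)"

text \<open>The previous player wins at s if every move of the opponent leads to a position from which
  the player to move wins (vacuously if there is no move: the player unable to move loses); the
  next player wins at s if some move leads to a position from which the previous player wins.
  Being inductive, both predicates mean that the win can be forced in finitely many moves; the
  lemmas below show that exactly one of them holds at every quadruple.\<close>

inductive P_position :: "nat \<Rightarrow> pos \<Rightarrow> bool" and N_position :: "nat \<Rightarrow> pos \<Rightarrow> bool"
  for t :: nat where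
  P_positionI: "(\<forall>s'. move t s s' \<longrightarrow> N_position t s') \<Longrightarrow> P_position t s"
| N_positionI: "move t s s' \<Longrightarrow> P_position t s' \<Longrightarrow> N_position t s"

lemma is_position_move:
  assumes "move t s s'" "is_position t s"
  shows "is_position t s'"
  using assms by cases (auto simp: pass_bound_def)

fun pos_size :: "pos \<Rightarrow> nat" where
  "pos_size (x, y, z, p) = x + y + z + p"

lemma move_pos_size: "move t s s' \<Longrightarrow> pos_size s' < pos_size s"
  by (induction rule: move.induct) (simp_all add: add_less_le_mono)

lemma N_position_iff: "N_position t s \<longleftrightarrow> (\<exists>s'. move t s s' \<and> P_position t s')"
  by (subst N_position.simps) blast

lemma N_position_iff_not_P: "N_position t s \<longleftrightarrow> \<not> P_position t s"
proof (induction "pos_size s" arbitrary: s rule: less_induct)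
  case less
  have "P_position t s \<longleftrightarrow> (\<forall>s'. move t s s' \<longrightarrow> N_position t s')"
    by (subst P_position.simps) blast
  also have "\<dots> \<longleftrightarrow> \<not> (\<exists>s'. move t s s' \<and> P_position t s')"
    using less move_pos_size by blast
  finally show ?case
    by (simp add: N_position_iff)
qed

lemma P_position_iff: "P_position t s \<longleftrightarrow> (\<forall>s'. move t s s' \<longrightarrow> \<not> P_position t s')"
  using N_position_iff N_position_iff_not_P by blast

end

theory Submission
  imports Defs
begin

text \<open>The pass flag behaves like a fourth Nim pile of size at most 1, except that entering the box
  [0, t]^3 clears it. For odd t the box is invariant under flipping the last bit of a pile, so a
  move clearing the flag never joins two positions of nim-sum 0, and if the winning Nim move leads
  into the box, flipping the last bit of the new pile compensates for the cleared flag. For even t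
  the position (t + 1, t, 0, 1) has nim-sum 0, but so does its successor (t, t, 0, 0).\<close>

lemma xor_eq_0_iff_nat: "a XOR b = 0 \<longleftrightarrow> a = b" for a b :: nat
  by (metis xor.assoc xor.right_neutral xor_self_eq xor.left_neutral)

text \<open>The last bit contributes at most 1, while a strict drop of the halves is worth at least
  2.\<close>

lemma xor_less_if_div2_less:
  "a div 2 XOR s div 2 < a div 2 \<Longrightarrow> a XOR s < a" for a s :: nat
  by (subst xor_nat_rec) (auto simp: of_bool_def)

lemma xor_one_less_if_odd: "odd a \<Longrightarrow> a XOR 1 < a" for a :: nat
  by (simp add: xor_one_eq odd_pos del: One_nat_def)

lemma xor_div2_nat: "(a XOR b) div 2 = a div 2 XOR b div 2" for a b :: nat
  using drop_bit_xor[of 1 a b] by (simp only: drop_bit_eq_div power_one_right)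

text \<open>Bouton's argument with the pass flag as fourth pile \<open>d\<close>. Halving all
  numbers keeps the leading bit of \<open>s\<close> until \<open>s = 1\<close>, where an odd summand
  can be reduced; the reduction then lifts back through the halvings.\<close>

lemma nim_reducible_pile:
  fixes a b c d s :: nat
  assumes "s = a XOR b XOR c XOR d" "s \<noteq> 0"
  shows "a XOR s < a \<or> b XOR s < b \<or> c XOR s < c \<or> d XOR s < d"
  using assms
proof (induction s arbitrary: a b c d rule: less_induct)
  case (less s)
  show ?case
  proof (cases "s div 2 = 0")
    case True
    then have s1: "s = 1" using less.prems by linarith
    then have "odd (a XOR b XOR c XOR d)" using less.prems by simp
    then have "odd a \<or> odd b \<or> odd c \<or> odd d" by (auto simp: even_xor_iff)
    then show ?thesis using xor_one_less_if_odd s1 by blast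
  next
    case False
    have eq: "s div 2 = a div 2 XOR b div 2 XOR c div 2 XOR d div 2"
      using less.prems(1) by (simp add: xor_div2_nat)
    have "s div 2 < s" using less.prems by simp
    from less.IH[OF this eq False] show ?thesis
      using xor_less_if_div2_less by blast
  qed
qed

text \<open>Flipping the last bit swaps 2k and 2k + 1, and an odd \<open>t\<close> is the larger
  member of its pair.\<close>

lemma xor_one_le_odd: "odd t \<Longrightarrow> u \<le> t \<Longrightarrow> u XOR 1 \<le> t" for u t :: nat
  by (cases "u = t") (auto simp: xor_one_eq simp del: One_nat_def)

abbreviation nim_zero :: "pos \<Rightarrow> bool" where
  "nim_zero s \<equiv> (case s of (x, y, z, p) \<Rightarrow> x XOR y XOR z XOR p = 0)"

lemma nim_zero_no_move:
  assumes "odd t" "move t s s'" "is_position t s" "nim_zero s"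
  shows "\<not> nim_zero s'"
proof -
  \<comment> \<open>One claim for all three piles: \<open>x\<close> shrinks to \<open>u\<close>,
    \<open>r\<close> is the nim-sum of the other two piles, and \<open>f\<close> is the pass bound
    after the move. If the flag is lost, only \<open>x\<close> can have exceeded \<open>t\<close>
    before.\<close>
  have pile: False
    if "u < x" "u XOR r XOR min p f = 0" "x XOR r XOR p = 0" "p \<in> {0, 1}" "f \<in> {0, 1}"
      "f = 0 \<Longrightarrow> u \<le> t" "f = 0 \<Longrightarrow> p = 1 \<Longrightarrow> t < x" for u x r p f :: nat
  proof (cases "min p f = p")
    case True
    with that show ?thesis by (simp add: xor_eq_0_iff_nat)
  next
    case False
    with that have p: "p = 1" "f = 0" by auto
    \<comment> \<open>Here \<open>r = u\<close>, since the flag after the move is 0; the flip then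
      keeps \<open>x\<close> at most \<open>t\<close>, against \<open>t < x\<close>.\<close>
    with that have "x = u XOR 1" by (simp add: xor_eq_0_iff_nat)
    with p that xor_one_le_odd[OF assms(1), of u] show ?thesis by simp
  qed
  from assms(2) show ?thesis
  proof cases
    case (move_x u x y z p)
    show ?thesis
    proof
      assume "nim_zero s'"
      then have u: "u XOR (y XOR z) XOR min p (pass_bound t u y z) = 0"
        using move_x by (simp add: xor.assoc xor.left_commute)
      have x: "x XOR (y XOR z) XOR p = 0"
        using assms(4) move_x by (simp add: xor.assoc xor.left_commute)
      show False
        by (rule pile[OF _ u x])
          (use assms(3) move_x in \<open>auto simp: pass_bound_def split: if_splits\<close>)
    qed
  next
    case (move_y u y x z p)
    show ?thesis
    proof
      assume "nim_zero s'"
      then have u: "u XOR (x XOR z) XOR min p (pass_bound t x u z) = 0"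
        using move_y by (simp add: xor.assoc xor.left_commute)
      have y: "y XOR (x XOR z) XOR p = 0"
        using assms(4) move_y by (simp add: xor.assoc xor.left_commute)
      show False
        by (rule pile[OF _ u y])
          (use assms(3) move_y in \<open>auto simp: pass_bound_def split: if_splits\<close>)
    qed
  next
    case (move_z u z x y p)
    show ?thesis
    proof
      assume "nim_zero s'"
      then have u: "u XOR (x XOR y) XOR min p (pass_bound t x y u) = 0"
        using move_z by (simp add: xor.assoc xor.left_commute)
      have z: "z XOR (x XOR y) XOR p = 0"
        using assms(4) move_z by (simp add: xor.assoc xor.left_commute)
      show False
        by (rule pile[OF _ u z])
          (use assms(3) move_z in \<open>auto simp: pass_bound_def split: if_splits\<close>)
    qed
  next
    case (move_pass x y z)
    with assms(4) show ?thesis by (auto simp flip: xor.assoc simp: xor_eq_0_iff_nat)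
  qed
qed

lemma nim_nonzero_move:
  assumes "odd t" "is_position t s" "\<not> nim_zero s"
  shows "\<exists>s'. move t s s' \<and> nim_zero s'"
proof -
  obtain x y z p where s: "s = (x, y, z, p)" by (cases s)
  define n where "n = x XOR y XOR z XOR p"
  have p: "p \<in> {0, 1}" "p \<le> pass_bound t x y z" using assms(2) s by auto
  \<comment> \<open>Again \<open>r\<close> is the nim-sum of the two untouched piles;
    \<open>q\<close> says that both are at most \<open>t\<close>, so that \<open>f u\<close> is the
    pass bound after moving to \<open>u\<close>.\<close>
  have pile: "\<exists>u<x. u XOR r XOR min p (f u) = 0"
    if "n = x XOR r XOR p" "x XOR n < x"
      "\<And>u. f u = (if u \<le> t \<and> q then 0 else 1)" "p = 1 \<Longrightarrow> q \<Longrightarrow> t < x"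
    for x r f q
  proof -
    \<comment> \<open>This is \<open>x XOR n\<close>, the reply of ordinary Nim; it works as long as
      the flag keeps its value.\<close>
    define u where "u = r XOR p"
    have u: "u < x" using that(1,2) by (simp add: u_def flip: xor.assoc)
    show ?thesis
    proof (cases "min p (f u) = p")
      case True
      then have "u XOR r XOR min p (f u) = 0"
        by (simp add: u_def xor_eq_0_iff_nat flip: xor.assoc)
      with u show ?thesis by blast
    next
      case False
      with p that(3)[of u] have q: "p = 1" "u \<le> t" "q" by (auto split: if_splits)
      \<comment> \<open>With the flag cleared, the right target is \<open>r\<close> itself. It still
        lies in the box, so the flag is cleared there too, and \<open>r\<close> \<le>
        \<open>t\<close> < \<open>x\<close> makes the move legal.\<close>
      have r: "r = u XOR 1" using q by (simp add: u_def xor.assoc)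
      with q xor_one_le_odd[OF assms(1)] have "r \<le> t" by simp
      moreover from this that(4) q have "r < x" by simp
      ultimately show ?thesis using that(3)[of r] q by (intro exI[of _ r]) simp
    qed
  qed
  consider "x XOR n < x" | "y XOR n < y" | "z XOR n < z" | "p XOR n < p"
    using nim_reducible_pile[OF n_def] assms(3) by (auto simp: s n_def)
  then show ?thesis
  proof cases
    case 1
    have "\<exists>u<x. u XOR (y XOR z) XOR min p (pass_bound t u y z) = 0"
    proof (rule pile)
      show "n = x XOR (y XOR z) XOR p" by (simp add: n_def xor.assoc xor.left_commute)
      show "pass_bound t u y z = (if u \<le> t \<and> (y \<le> t \<and> z \<le> t) then 0 else 1)" for u
        by (simp add: pass_bound_def)
      \<comment> \<open>An available pass requires some pile above \<open>t\<close>, and only this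
        one is left.\<close>
      show "t < x" if "p = 1" "y \<le> t \<and> z \<le> t"
        using that p(2) by (auto simp: pass_bound_def split: if_splits)
    qed fact
    then obtain u where "u < x"
      and "u XOR (y XOR z) XOR min p (pass_bound t u y z) = 0" by blast
    then show ?thesis unfolding s
      by (intro exI[of _ "(u, y, z, min p (pass_bound t u y z))"])
        (simp add: move_x xor.assoc xor.left_commute)
  next
    case 2
    have "\<exists>u<y. u XOR (x XOR z) XOR min p (pass_bound t x u z) = 0"
    proof (rule pile)
      show "n = y XOR (x XOR z) XOR p" by (simp add: n_def xor.assoc xor.left_commute)
      show "pass_bound t x u z = (if u \<le> t \<and> (x \<le> t \<and> z \<le> t) then 0 else 1)" for u
        by (simp add: pass_bound_def)
      show "t < y" if "p = 1" "x \<le> t \<and> z \<le> t"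
        using that p(2) by (auto simp: pass_bound_def split: if_splits)
    qed fact
    then obtain u where "u < y"
      and "u XOR (x XOR z) XOR min p (pass_bound t x u z) = 0" by blast
    then show ?thesis unfolding s
      by (intro exI[of _ "(x, u, z, min p (pass_bound t x u z))"])
        (simp add: move_y xor.assoc xor.left_commute)
  next
    case 3
    have "\<exists>u<z. u XOR (x XOR y) XOR min p (pass_bound t x y u) = 0"
    proof (rule pile)
      show "n = z XOR (x XOR y) XOR p" by (simp add: n_def xor.assoc xor.left_commute)
      show "pass_bound t x y u = (if u \<le> t \<and> (x \<le> t \<and> y \<le> t) then 0 else 1)" for u
        by (simp add: pass_bound_def)
      show "t < z" if "p = 1" "x \<le> t \<and> y \<le> t"
        using that p(2) by (auto simp: pass_bound_def split: if_splits)
    qed fact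
    then obtain u where "u < z"
      and "u XOR (x XOR y) XOR min p (pass_bound t x y u) = 0" by blast
    then show ?thesis unfolding s
      by (intro exI[of _ "(x, y, u, min p (pass_bound t x y u))"])
        (simp add: move_z xor.assoc xor.left_commute)
  next
    \<comment> \<open>Reducing the fourth pile is the pass: it forces \<open>p = 1\<close> and
      \<open>n = 1\<close>, so the three piles alone have nim-sum 0.\<close>
    case 4
    with p have "p = 1" "1 XOR n = 0" by auto
    then have "x XOR y XOR z = 0" by (simp add: n_def xor_eq_0_iff_nat flip: xor.assoc)
        (metis xor.assoc xor_self_eq xor.right_neutral)
    with \<open>p = 1\<close> move_pass[of t x y z] show ?thesis
      unfolding s by (intro exI[of _ "(x, y, z, 0)"]) simp
  qed
qed

text \<open>Moves shrink \<open>pos_size\<close> and preserve \<open>is_position\<close>, so the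
  induction hypothesis covers every option.\<close>

lemma P_position_iff_nim_zero:
  assumes "odd t" "is_position t s"
  shows "P_position t s \<longleftrightarrow> nim_zero s"
  using assms(2)
proof (induction "pos_size s" arbitrary: s rule: less_induct)
  case less
  have "P_position t s \<longleftrightarrow> (\<forall>s'. move t s s' \<longrightarrow> \<not> nim_zero s')"
    using less move_pos_size is_position_move P_position_iff[of t s] by metis
  also have "\<dots> \<longleftrightarrow> nim_zero s"
    using nim_zero_no_move nim_nonzero_move assms(1) less.prems by metis
  finally show ?case .
qed

theorem theorem8:
  fixes t :: nat
  shows "(\<forall>x y z p :: nat. is_position t (x, y, z, p) \<longrightarrow>
            (P_position t (x, y, z, p) \<longleftrightarrow> x XOR y XOR z XOR p = 0))
         \<longleftrightarrow> odd t"
proof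
  assume P: "\<forall>x y z p :: nat. is_position t (x, y, z, p) \<longrightarrow>
            (P_position t (x, y, z, p) \<longleftrightarrow> x XOR y XOR z XOR p = 0)"
  show "odd t"
  proof
    assume "even t"
    \<comment> \<open>Adding 1 to an even number only sets its last bit, which the flag cancels in
      the nim-sum.\<close>
    then have "t + 1 = t XOR 1" by (simp add: xor_one_eq del: One_nat_def)
    then have "(t + 1) XOR t XOR 0 XOR 1 = 0" by (simp add: xor_eq_0_iff_nat)
    then have "P_position t (t + 1, t, 0, 1)" using P by (simp add: pass_bound_def)
    moreover have "P_position t (t, t, 0, 0)" using P by simp
    moreover have "move t (t + 1, t, 0, 1) (t, t, 0, 0)"
      using move_x[of t "t + 1" t t 0 1] by (simp add: pass_bound_def)
    ultimately show False using P_position_iff by blast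
  qed
next
  assume "odd t"
  then show "\<forall>x y z p :: nat. is_position t (x, y, z, p) \<longrightarrow>
            (P_position t (x, y, z, p) \<longleftrightarrow> x XOR y XOR z XOR p = 0)"
    using P_position_iff_nim_zero by auto
qed

end
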